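(* Let $n\ge2$. In the polycyclic monoid $P_n$ on $n$ generators, the relation $\sim_c$ is strictly contained in the relation $\sim_p$: $\sim_c\;\subseteq\;\sim_p$ and $\sim_c\;\ne\;\sim_p$ (as subsets of $P_n\times P_n$).
   Context: For elements $a,b$ of a monoid $M$, $a\sim_p b$ means that there exist $u,v\in M$ with $a=uv$ and $b=vu$. For a monoid $M$ with zero and $a\in M\setminus\{0\}$, let $\mathbb P(a)=\{g\in M:(\forall m\in M)\ mag=0\Rightarrow ma=0\}$, and let $\mathbb P(0)=\{0\}$; if $M$ has no zero, $\mathbb P(a)=M$ for all $a\in M$. Define $a\sim_c b$ to mean: there exist $g\in\mathbb P(a)$ and $h\in\mathbb P(b)$ with $ag=gb$ and $bh=ha$. Polycyclic monoid: let $n\ge2$, $A_n=\{p_1,\dots,p_n\}$, $A_n^{-1}=\{p_1^{-1},\dots,p_n^{-1}\}$ a disjoint copy, $\Sigma=A_n\cup A_n^{-1}$, $\Sigma_0=\Sigma\cup\{0\}$. $P_n$ is the monoid generated by $\Sigma_0$ with defining relations $p_i^{-1}p_i=1$, $p_i^{-1}p_j=0$ for $i\ne j$, and $x0=0$, $0x=0$, $00=0$ for $x\in\Sigma$. The element $0$ is the zero of $P_n$. *)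

theory Defs
  imports "HOL-Algebra.Group"
begin

section \<open>Monoid presentations\<close>

inductive_set pres_cong :: "'x set \<Rightarrow> ('x list \<times> 'x list) set \<Rightarrow> ('x list \<times> 'x list) set"
  for X :: "'x set" and R :: "('x list \<times> 'x list) set" where
  rel: "(u, v) \<in> R \<Longrightarrow> u \<in> lists X \<Longrightarrow> v \<in> lists X \<Longrightarrow> (u, v) \<in> pres_cong X R"
| refl: "u \<in> lists X \<Longrightarrow> (u, u) \<in> pres_cong X R"
| sym: "(u, v) \<in> pres_cong X R \<Longrightarrow> (v, u) \<in> pres_cong X R"
| trans: "(u, v) \<in> pres_cong X R \<Longrightarrow> (v, w) \<in> pres_cong X R \<Longrightarrow> (u, w) \<in> pres_cong X R"
| append: "(u, u') \<in> pres_cong X R \<Longrightarrow> (v, v') \<in> pres_cong X R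
    \<Longrightarrow> (u @ v, u' @ v') \<in> pres_cong X R"

text \<open>The product of two classes is given as a union of classes of concatenated representatives;
  all the classes in this union coincide, see \<open>presented_monoid_mult\<close>.\<close>

definition presented_monoid :: "'x set \<Rightarrow> ('x list \<times> 'x list) set \<Rightarrow> 'x list set monoid" where
  "presented_monoid X R =
    \<lparr>carrier = lists X // pres_cong X R,
     mult = (\<lambda>A B. \<Union>u\<in>A. \<Union>v\<in>B. pres_cong X R `` {u @ v}),
     one = pres_cong X R `` {[]}\<rparr>"

lemma pres_cong_in_lists:
  "(u, v) \<in> pres_cong X R \<Longrightarrow> u \<in> lists X \<and> v \<in> lists X"
  by (induction rule: pres_cong.induct) auto

lemma equiv_pres_cong: "equiv (lists X) (pres_cong X R)"
proof (rule equivI)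
  show "pres_cong X R \<subseteq> lists X \<times> lists X"
    using pres_cong_in_lists by fast
  show "refl_on (lists X) (pres_cong X R)"
    by (rule refl_onI) (rule pres_cong.refl)
  show "Relation.sym (pres_cong X R)"
    by (rule symI) (rule pres_cong.sym)
  show "Relation.trans (pres_cong X R)"
    by (rule transI) (rule pres_cong.trans)
qed

lemma presented_monoid_mult:
  assumes "u \<in> lists X" "v \<in> lists X"
  shows "mult (presented_monoid X R) (pres_cong X R `` {u}) (pres_cong X R `` {v})
    = pres_cong X R `` {u @ v}"
proof -
  have eq: "pres_cong X R `` {u' @ v'} = pres_cong X R `` {u @ v}"
    if "u' \<in> pres_cong X R `` {u}" "v' \<in> pres_cong X R `` {v}" for u' v'
  proof -
    have "(u @ v, u' @ v') \<in> pres_cong X R"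
      using that by (intro pres_cong.append) simp_all
    then show ?thesis
      by (rule equiv_class_eq[OF equiv_pres_cong, symmetric])
  qed
  have "(\<Union>u'\<in>pres_cong X R `` {u}. \<Union>v'\<in>pres_cong X R `` {v}. pres_cong X R `` {u' @ v'})
    = (\<Union>u'\<in>pres_cong X R `` {u}. \<Union>v'\<in>pres_cong X R `` {v}. pres_cong X R `` {u @ v})"
    by (intro SUP_cong HOL.refl eq)
  moreover have "u \<in> pres_cong X R `` {u}" "v \<in> pres_cong X R `` {v}"
    using assms by (simp_all add: pres_cong.refl)
  ultimately show ?thesis
    unfolding presented_monoid_def by auto
qed

lemma monoid_presented_monoid: "monoid (presented_monoid X R)"
proof -
  have cl: "x \<in> carrier (presented_monoid X R) \<longleftrightarrow> (\<exists>u\<in>lists X. x = pres_cong X R `` {u})" for x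
    by (auto simp: presented_monoid_def quotient_def)
  have one: "one (presented_monoid X R) = pres_cong X R `` {[]}"
    by (simp add: presented_monoid_def)
  show ?thesis
  proof (rule monoidI)
    fix x y assume "x \<in> carrier (presented_monoid X R)" "y \<in> carrier (presented_monoid X R)"
    then obtain u v where "u \<in> lists X" "v \<in> lists X"
      "x = pres_cong X R `` {u}" "y = pres_cong X R `` {v}"
      unfolding cl by blast
    then show "mult (presented_monoid X R) x y \<in> carrier (presented_monoid X R)"
      unfolding cl by (intro bexI[of _ "u @ v"]) (simp_all add: presented_monoid_mult)
  next
    show "one (presented_monoid X R) \<in> carrier (presented_monoid X R)"
      unfolding cl one by (rule bexI[of _ "[]"]) auto
  next
    fix x y z
    assume "x \<in> carrier (presented_monoid X R)" "y \<in> carrier (presented_monoid X R)"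
      "z \<in> carrier (presented_monoid X R)"
    then obtain u v w where "u \<in> lists X" "v \<in> lists X" "w \<in> lists X"
      "x = pres_cong X R `` {u}" "y = pres_cong X R `` {v}" "z = pres_cong X R `` {w}"
      unfolding cl by blast
    then show "mult (presented_monoid X R) (mult (presented_monoid X R) x y) z
      = mult (presented_monoid X R) x (mult (presented_monoid X R) y z)"
      by (simp add: presented_monoid_mult)
  next
    fix x assume "x \<in> carrier (presented_monoid X R)"
    then obtain u where "u \<in> lists X" "x = pres_cong X R `` {u}"
      unfolding cl by blast
    then show "mult (presented_monoid X R) (one (presented_monoid X R)) x = x"
      and "mult (presented_monoid X R) x (one (presented_monoid X R)) = x"
      using presented_monoid_mult[of "[]" X u R] presented_monoid_mult[of u X "[]" R]
      by (simp_all add: one)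
  qed
qed

section \<open>Polycyclic monoids\<close>

datatype letter = Gen nat | Inv nat | Zero

definition polycyclic_letters :: "nat \<Rightarrow> letter set" where
  "polycyclic_letters n = Gen ` {1..n} \<union> Inv ` {1..n}"

definition polycyclic_rels :: "nat \<Rightarrow> (letter list \<times> letter list) set" where
  "polycyclic_rels n =
    {([Inv i, Gen i], []) | i. i \<in> {1..n}}
    \<union> {([Inv i, Gen j], [Zero]) | i j. i \<in> {1..n} \<and> j \<in> {1..n} \<and> i \<noteq> j}
    \<union> {([x, Zero], [Zero]) | x. x \<in> polycyclic_letters n}
    \<union> {([Zero, x], [Zero]) | x. x \<in> polycyclic_letters n}
    \<union> {([Zero, Zero], [Zero])}"

definition polycyclic :: "nat \<Rightarrow> letter list set monoid" where
  "polycyclic n = presented_monoid (insert Zero (polycyclic_letters n)) (polycyclic_rels n)"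

section \<open>Conjugacy in monoids\<close>

definition is_zero :: "('a, 'b) monoid_scheme \<Rightarrow> 'a \<Rightarrow> bool" where
  "is_zero M z \<longleftrightarrow> z \<in> carrier M \<and> (\<forall>x\<in>carrier M. z \<otimes>\<^bsub>M\<^esub> x = z \<and> x \<otimes>\<^bsub>M\<^esub> z = z)"

text \<open>A zero is unique if it exists. If \<open>M\<close> has none, the second branch applies and its condition
  is vacuous, so that \<open>conj_dom M a = carrier M\<close>.\<close>

definition conj_dom :: "('a, 'b) monoid_scheme \<Rightarrow> 'a \<Rightarrow> 'a set" where
  "conj_dom M a =
    (if is_zero M a then {a}
     else {g \<in> carrier M. \<forall>z. is_zero M z \<longrightarrow>
       (\<forall>m\<in>carrier M. m \<otimes>\<^bsub>M\<^esub> a \<otimes>\<^bsub>M\<^esub> g = z \<longrightarrow> m \<otimes>\<^bsub>M\<^esub> a = z)})"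

definition conj_p :: "('a, 'b) monoid_scheme \<Rightarrow> ('a \<times> 'a) set" where
  "conj_p M = {(a, b) \<in> carrier M \<times> carrier M.
    \<exists>u\<in>carrier M. \<exists>v\<in>carrier M. a = u \<otimes>\<^bsub>M\<^esub> v \<and> b = v \<otimes>\<^bsub>M\<^esub> u}"

definition conj_c :: "('a, 'b) monoid_scheme \<Rightarrow> ('a \<times> 'a) set" where
  "conj_c M = {(a, b) \<in> carrier M \<times> carrier M.
    \<exists>g\<in>conj_dom M a. \<exists>h\<in>conj_dom M b. a \<otimes>\<^bsub>M\<^esub> g = g \<otimes>\<^bsub>M\<^esub> b \<and> b \<otimes>\<^bsub>M\<^esub> h = h \<otimes>\<^bsub>M\<^esub> a}"

lemma is_zero_polycyclic:
  "is_zero (polycyclic n)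
    (pres_cong (insert Zero (polycyclic_letters n)) (polycyclic_rels n) `` {[Zero]})"
proof -
  define X where "X = insert Zero (polycyclic_letters n)"
  define C where "C = pres_cong X (polycyclic_rels n)"
  have Z: "[Zero] \<in> lists X" by (simp add: X_def)
  have step: "([x, Zero], [Zero]) \<in> C" "([Zero, x], [Zero]) \<in> C" if "x \<in> X" for x
    using that unfolding C_def
    by (auto simp: X_def polycyclic_rels_def intro!: pres_cong.rel)
  have absorb: "(u @ [Zero], [Zero]) \<in> C \<and> (Zero # u, [Zero]) \<in> C" if "u \<in> lists X" for u
    using that
  proof (induction u)
    case Nil
    then show ?case using Z by (auto simp: C_def intro: pres_cong.refl)
  next
    case (Cons x u)
    have x: "([x], [x]) \<in> C" and u: "(u, u) \<in> C"
      using Cons.hyps by (auto simp: C_def intro!: pres_cong.refl)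
    have "([x] @ (u @ [Zero]), [x] @ [Zero]) \<in> C" "([Zero, x] @ u, [Zero] @ u) \<in> C"
      using pres_cong.append[OF x[unfolded C_def], of "u @ [Zero]" "[Zero]"] Cons.IH
        pres_cong.append[OF step(2)[OF Cons.hyps(1), unfolded C_def] u[unfolded C_def]]
      by (simp_all add: C_def)
    moreover have "(v, [Zero]) \<in> C" if "(v, w) \<in> C" "(w, [Zero]) \<in> C" for v w
      using that unfolding C_def by (rule pres_cong.trans)
    ultimately show ?case
      using Cons.IH step(1)[OF Cons.hyps(1)] by simp
  qed
  have eq: "C `` {u @ [Zero]} = C `` {[Zero]}" "C `` {Zero # u} = C `` {[Zero]}"
    if "u \<in> lists X" for u
    using absorb[OF that] equiv_class_eq[OF equiv_pres_cong, of _ _ X "polycyclic_rels n"]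
    unfolding C_def by blast+
  have "is_zero (presented_monoid X (polycyclic_rels n)) (C `` {[Zero]})"
    unfolding is_zero_def
  proof (intro conjI ballI)
    show "C `` {[Zero]} \<in> carrier (presented_monoid X (polycyclic_rels n))"
      using Z by (auto simp: presented_monoid_def C_def intro: quotientI)
  next
    fix x assume "x \<in> carrier (presented_monoid X (polycyclic_rels n))"
    then obtain u where u: "u \<in> lists X" "x = C `` {u}"
      by (auto simp: presented_monoid_def C_def quotient_def)
    show "mult (presented_monoid X (polycyclic_rels n)) (C `` {[Zero]}) x = C `` {[Zero]}"
      using presented_monoid_mult[OF Z u(1)] eq[OF u(1)] u(2) by (simp add: C_def)
    show "mult (presented_monoid X (polycyclic_rels n)) x (C `` {[Zero]}) = C `` {[Zero]}"
      using presented_monoid_mult[OF u(1) Z] eq[OF u(1)] u(2) by (simp add: C_def)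
  qed
  then show ?thesis by (simp add: polycyclic_def X_def C_def)
qed

end

theory Submission
  imports Defs "HOL-Library.Sublist"
begin

text \<open>Every nonzero element of \<open>P\<^sub>n\<close> is \<open>y x\<^sup>-\<^sup>1\<close> for unique positive words \<open>y\<close>, \<open>x\<close>; uniqueness
  follows from the action of \<open>P\<^sub>n\<close> by partial injections on words, where \<open>y x\<^sup>-\<^sup>1\<close> maps \<open>x s\<close> to
  \<open>y s\<close>. As \<open>n \<ge> 2\<close>, an element \<open>v u\<^sup>-\<^sup>1\<close> of \<open>\<bbbP>(y x\<^sup>-\<^sup>1)\<close> must have \<open>v\<close> a prefix of \<open>x\<close>, say
  \<open>x = v w\<close>. If such an element conjugates \<open>a = y x\<^sup>-\<^sup>1\<close> to \<open>b = y' x'\<^sup>-\<^sup>1\<close>, then either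
  \<open>a = v c v\<^sup>-\<^sup>1\<close> and \<open>b = u c u\<^sup>-\<^sup>1\<close> for some \<open>c\<close>, or \<open>a = y w\<^sup>-\<^sup>1 y\<^sup>-\<^sup>1\<close> and
  \<open>b = y' w'\<^sup>-\<^sup>1 y'\<^sup>-\<^sup>1\<close> with \<open>w\<close> and \<open>w'\<close> conjugate words; both cases give \<open>a \<sim>\<^sub>p b\<close>. The inclusion is
  strict since \<open>p\<^sub>2 p\<^sub>1\<^sup>-\<^sup>1 \<noteq> 0\<close> is \<open>\<sim>\<^sub>p\<close>-related to \<open>p\<^sub>1\<^sup>-\<^sup>1 p\<^sub>2 = 0\<close>, whereas \<open>0\<close> is
  \<open>\<sim>\<^sub>c\<close>-related only to itself.\<close>

text \<open>Lyndon-Schuetzenberger: copies of \<open>w'\<close> are stripped from the front of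
  \<open>s\<close> until \<open>s\<close> is a prefix of \<open>w'\<close>; the overlap then gives
  \<open>p = s\<close> and \<open>q = t\<close>.\<close>

lemma conjugate_words:
  assumes "s @ w = w' @ s"
  shows "\<exists>p q. w = q @ p \<and> w' = p @ q"
  using assms
proof (induction "length s" arbitrary: s rule: less_induct)
  case less
  consider t where "s = w' @ t" "t @ w = s" | t where "w' = s @ t" "w = t @ s"
    using less.prems by (auto simp: append_eq_append_conv2)
  then show ?case
  proof cases
    case 1
    show ?thesis
    \<comment> \<open>An empty \<open>w'\<close> is split off because \<open>t\<close> would then be
      no shorter than \<open>s\<close>.\<close>
    proof (cases "w' = []")
      case True
      then show ?thesis using less.prems by simp
    next
      case False
      then show ?thesis using less.hyps[of t] 1 by simp
    qed
  next
    case 2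
    then show ?thesis by blast
  qed
qed

section \<open>The action on words\<close>

primrec letter_action :: "letter \<Rightarrow> (nat list \<times> nat list) set" where
  "letter_action (Gen i) = {(s, i # s) | s. True}"
| "letter_action (Inv i) = {(i # s, s) | s. True}"
| "letter_action Zero = {}"

text \<open>Words act from the left, so the last letter is applied first.\<close>

primrec action :: "letter list \<Rightarrow> (nat list \<times> nat list) set" where
  "action [] = Id"
| "action (l # u) = action u O letter_action l"

lemma action_append: "action (u @ v) = action v O action u"
  by (induction u) auto

text \<open>Makes the action an invariant of elements of the monoid, so it can separate classes.
  Both sides of each defining relation act equally, with \<open>Zero\<close> as the empty
  map.\<close>

lemma action_pres_cong:
  assumes "(u, v) \<in> pres_cong X (polycyclic_rels n)"
  shows "action u = action v"
  using assms
proof induction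
  case (rel u v)
  then show ?case by (auto simp: polycyclic_rels_def relcomp_unfold)
qed (auto simp: action_append)

definition normal_word :: "nat list \<Rightarrow> nat list \<Rightarrow> letter list" where
  "normal_word y x = map Gen y @ map Inv (rev x)"

lemma action_normal_word: "action (normal_word y x) = {(x @ s, y @ s) | s. True}"
proof -
  have "action (map Gen y) = {(s, y @ s) | s. True}"
    by (induction y) auto
  moreover have "action (map Inv (rev x)) = {(x @ s, s) | s. True}"
    by (induction x) (auto simp: action_append)
  ultimately show ?thesis by (auto simp: normal_word_def action_append)
qed

text \<open>The pair \<open>(x, y)\<close> is the shortest in its graph. If the graphs agree, each
  of the two shortest pairs extends the other by a common suffix, which must be empty.\<close>

lemma action_normal_word_eq_iff:
  "action (normal_word y x) = action (normal_word y' x') \<longleftrightarrow> y = y' \<and> x = x'"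
proof
  assume eq: "action (normal_word y x) = action (normal_word y' x')"
  have self: "(x, y) \<in> action (normal_word y x)" for x y
    by (simp add: action_normal_word)
  have "(x, y) \<in> action (normal_word y' x')" "(x', y') \<in> action (normal_word y x)"
    using self[of x y] self[of x' y'] eq by simp_all
  then show "y = y' \<and> x = x'" by (auto simp: action_normal_word)
qed simp

lemma action_normal_word_ne: "action (normal_word y x) \<noteq> {}"
  by (auto simp: action_normal_word)

section \<open>Normal forms in the polycyclic monoid\<close>

context
  fixes n :: nat
begin

definition word_class :: "letter list \<Rightarrow> letter list set" where
  "word_class u = pres_cong (insert Zero (polycyclic_letters n)) (polycyclic_rels n) `` {u}"

abbreviation alphabet :: "letter set" where
  "alphabet \<equiv> insert Zero (polycyclic_letters n)"

abbreviation words :: "nat list set" where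
  "words \<equiv> lists {1..n}"

abbreviation zero_elt :: "letter list set" where
  "zero_elt \<equiv> word_class [Zero]"

abbreviation normal_elt :: "nat list \<Rightarrow> nat list \<Rightarrow> letter list set" where
  "normal_elt y x \<equiv> word_class (normal_word y x)"

lemma normal_word_in_lists:
  "y \<in> words \<Longrightarrow> x \<in> words \<Longrightarrow> normal_word y x \<in> lists alphabet"
  by (auto simp: normal_word_def polycyclic_letters_def)

lemma word_class_eqI:
  "(u, v) \<in> pres_cong alphabet (polycyclic_rels n) \<Longrightarrow> word_class u = word_class v"
  unfolding word_class_def by (rule equiv_class_eq[OF equiv_pres_cong])

lemma word_class_eqD:
  assumes "u \<in> lists alphabet" "word_class u = word_class v"
  shows "action u = action v"
proof -
  have "u \<in> word_class u"
    using assms(1) by (auto simp: word_class_def intro: pres_cong.refl)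
  then have "(v, u) \<in> pres_cong alphabet (polycyclic_rels n)"
    unfolding assms(2) by (simp add: word_class_def)
  then show ?thesis using action_pres_cong by metis
qed

lemma mult_word_class:
  "u \<in> lists alphabet \<Longrightarrow> v \<in> lists alphabet \<Longrightarrow>
    word_class u \<otimes>\<^bsub>polycyclic n\<^esub> word_class v = word_class (u @ v)"
  unfolding word_class_def polycyclic_def by (rule presented_monoid_mult)

lemma carrier_polycyclic: "carrier (polycyclic n) = word_class ` lists alphabet"
  by (auto simp: polycyclic_def presented_monoid_def quotient_def word_class_def)

lemma is_zero_iff: "is_zero (polycyclic n) z \<longleftrightarrow> z = zero_elt"
proof -
  have "is_zero (polycyclic n) zero_elt"
    unfolding word_class_def by (rule is_zero_polycyclic)
  then show ?thesis by (metis is_zero_def)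
qed

lemma zero_elt_carrier: "zero_elt \<in> carrier (polycyclic n)"
  using is_zero_iff by (auto simp: is_zero_def)

lemma zero_elt_mult:
  assumes "a \<in> carrier (polycyclic n)"
  shows "zero_elt \<otimes>\<^bsub>polycyclic n\<^esub> a = zero_elt" "a \<otimes>\<^bsub>polycyclic n\<^esub> zero_elt = zero_elt"
  using assms is_zero_iff[of zero_elt] by (auto simp: is_zero_def)

lemma word_class_append:
  assumes "u \<in> lists alphabet" "v \<in> lists alphabet" "u' \<in> lists alphabet" "v' \<in> lists alphabet"
    and "word_class u = word_class u'" "word_class v = word_class v'"
  shows "word_class (u @ v) = word_class (u' @ v')"
  using assms mult_word_class by metis

text \<open>Only \<open>Inv i\<close> can interact with the first letter of \<open>y\<close>: it
  cancels an equal generator and gives zero with a different one.\<close>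

lemma word_class_Cons_normal_word:
  assumes l: "l \<in> alphabet" and yx: "y \<in> words" "x \<in> words"
  shows "word_class (l # normal_word y x) = zero_elt \<or>
    (\<exists>y'\<in>words. \<exists>x'\<in>words. word_class (l # normal_word y x) = normal_elt y' x')"
proof (cases l)
  case (Gen i)
  then have "l # normal_word y x = normal_word (i # y) x" "i # y \<in> words"
    using l yx by (auto simp: normal_word_def polycyclic_letters_def)
  then show ?thesis using yx by metis
next
  case (Inv i)
  then have i: "i \<in> {1..n}" using l by (auto simp: polycyclic_letters_def)
  show ?thesis
  proof (cases y)
    case Nil
    \<comment> \<open>Inversion reverses words, so a new leftmost \<open>Inv i\<close> is the last
      letter of \<open>x\<close>.\<close>
    then have "l # normal_word y x = normal_word [] (x @ [i])"
      by (simp add: normal_word_def Inv)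
    moreover have "x @ [i] \<in> words" "[] \<in> words" using i yx by auto
    ultimately show ?thesis by metis
  next
    case (Cons j y')
    have j: "j \<in> {1..n}" and y': "y' \<in> words" using yx Cons by auto
    have split: "l # normal_word y x = [Inv i, Gen j] @ normal_word y' x"
      by (simp add: normal_word_def Inv Cons)
    have ij: "[Inv i, Gen j] \<in> lists alphabet"
      using i j by (auto simp: polycyclic_letters_def)
    show ?thesis
    proof (cases "i = j")
      case True
      have "word_class [Inv i, Gen j] = word_class []"
        by (intro word_class_eqI pres_cong.rel) (use i ij True in \<open>auto simp: polycyclic_rels_def\<close>)
      then have "word_class ([Inv i, Gen j] @ normal_word y' x) = word_class ([] @ normal_word y' x)"
        by (intro word_class_append) (use ij y' yx normal_word_in_lists in auto)
      then show ?thesis using split y' yx by auto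
    next
      case False
      have "word_class [Inv i, Gen j] = zero_elt"
        by (intro word_class_eqI pres_cong.rel)
          (use i j ij False in \<open>auto simp: polycyclic_rels_def\<close>)
      moreover have nl: "normal_word y' x \<in> lists alphabet" using y' yx normal_word_in_lists by simp
      ultimately have "word_class (l # normal_word y x)
          = zero_elt \<otimes>\<^bsub>polycyclic n\<^esub> word_class (normal_word y' x)"
        using mult_word_class[OF ij nl] split by simp
      also have "\<dots> = zero_elt"
        using nl by (intro zero_elt_mult) (auto simp: carrier_polycyclic)
      finally show ?thesis by simp
    qed
  qed
next
  case Zero
  have nl: "normal_word y x \<in> lists alphabet" using yx normal_word_in_lists by simp
  have "word_class (l # normal_word y x) = zero_elt \<otimes>\<^bsub>polycyclic n\<^esub> word_class (normal_word y x)"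
    using mult_word_class[OF _ nl, of "[Zero]"] Zero by simp
  also have "\<dots> = zero_elt"
    using nl by (intro zero_elt_mult) (auto simp: carrier_polycyclic)
  finally show ?thesis by simp
qed

lemma word_class_cases:
  assumes "u \<in> lists alphabet"
  shows "word_class u = zero_elt \<or> (\<exists>y\<in>words. \<exists>x\<in>words. word_class u = normal_elt y x)"
  using assms
proof induction
  case Nil
  have "[] = normal_word [] []" by (simp add: normal_word_def)
  then show ?case by (metis lists.Nil)
next
  case (Cons l u)
  have l: "[l] \<in> lists alphabet" using Cons.hyps by simp
  have split: "word_class (l # u) = word_class [l] \<otimes>\<^bsub>polycyclic n\<^esub> word_class u"
    using mult_word_class[OF l Cons.hyps(2)] by simp
  from Cons.IH show ?case
  proof (elim disjE bexE)
    assume "word_class u = zero_elt"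
    then have "word_class (l # u) = zero_elt"
      unfolding split using zero_elt_mult(2) l carrier_polycyclic by force
    then show ?thesis ..
  next
    fix y x assume yx: "y \<in> words" "x \<in> words" and "word_class u = normal_elt y x"
    then have "word_class (l # u) = word_class (l # normal_word y x)"
      using mult_word_class[OF l normal_word_in_lists] split by simp
    then show ?thesis using word_class_Cons_normal_word[OF Cons.hyps(1) yx] by simp
  qed
qed

lemma polycyclic_cases:
  assumes "a \<in> carrier (polycyclic n)"
  obtains "a = zero_elt" | y x where "y \<in> words" "x \<in> words" "a = normal_elt y x"
  using assms word_class_cases unfolding carrier_polycyclic by blast

text \<open>The action is faithful: every word reduces to zero or a normal form, and these act
  differently. Products can thus be computed by composing partial maps.\<close>

lemma word_class_eq_iff:
  assumes "u \<in> lists alphabet" "v \<in> lists alphabet"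
  shows "word_class u = word_class v \<longleftrightarrow> action u = action v"
proof
  assume eq: "action u = action v"
  have zero: "action w = {}" if "w \<in> lists alphabet" "word_class w = zero_elt" for w
    using word_class_eqD[OF that] by simp
  have normal: "action w = action (normal_word y x)"
    if "w \<in> lists alphabet" "word_class w = normal_elt y x" for w y x
    using word_class_eqD[OF that] .
  show "word_class u = word_class v"
    using word_class_cases[OF assms(1)] word_class_cases[OF assms(2)] eq
    by (metis zero normal assms action_normal_word_ne action_normal_word_eq_iff)
qed (use word_class_eqD assms in blast)

section \<open>Arithmetic of normal forms, governed by prefix comparison of the inner words\<close>

lemma normal_elt_carrier:
  "y \<in> words \<Longrightarrow> x \<in> words \<Longrightarrow> normal_elt y x \<in> carrier (polycyclic n)"
  using normal_word_in_lists by (simp add: carrier_polycyclic)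

lemma normal_elt_ne_zero:
  "y \<in> words \<Longrightarrow> x \<in> words \<Longrightarrow> normal_elt y x \<noteq> zero_elt"
  using word_class_eqD[OF normal_word_in_lists, of y x "[Zero]"] action_normal_word_ne by auto

lemma normal_elt_eq_iff:
  "y \<in> words \<Longrightarrow> x \<in> words \<Longrightarrow> normal_elt y x = normal_elt y' x' \<longleftrightarrow> y = y' \<and> x = x'"
  using word_class_eqD[OF normal_word_in_lists] action_normal_word_eq_iff by metis

lemma normal_elt_mult_left:
  assumes "y \<in> words" "x \<in> words" "u \<in> words" "w \<in> words"
  shows "normal_elt y x \<otimes>\<^bsub>polycyclic n\<^esub> normal_elt (x @ w) u = normal_elt (y @ w) u"
proof -
  have "action (normal_word y x @ normal_word (x @ w) u) = action (normal_word (y @ w) u)"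
    by (auto simp: action_append action_normal_word relcomp_unfold)
  then show ?thesis
    using assms by (simp add: mult_word_class word_class_eq_iff normal_word_in_lists)
qed

lemma normal_elt_mult_right:
  assumes "y \<in> words" "v \<in> words" "u \<in> words" "w \<in> words"
  shows "normal_elt y (v @ w) \<otimes>\<^bsub>polycyclic n\<^esub> normal_elt v u = normal_elt y (u @ w)"
proof -
  have "action (normal_word y (v @ w) @ normal_word v u) = action (normal_word y (u @ w))"
    by (auto simp: action_append action_normal_word relcomp_unfold)
  then show ?thesis
    using assms by (simp add: mult_word_class word_class_eq_iff normal_word_in_lists)
qed

text \<open>Incomparable words have no common extension, so the composite map is empty.\<close>

lemma normal_elt_mult_zero:
  assumes "y \<in> words" "x \<in> words" "v \<in> words" "u \<in> words" "x \<parallel> v"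
  shows "normal_elt y x \<otimes>\<^bsub>polycyclic n\<^esub> normal_elt v u = zero_elt"
proof -
  have "x @ s \<noteq> v @ t" for s t
    using assms(5) by (metis parallelE prefixI prefix_same_cases)
  then have "action (normal_word y x @ normal_word v u) = action [Zero]"
    by (auto simp: action_append action_normal_word relcomp_unfold)
  then show ?thesis
    using assms by (simp add: mult_word_class word_class_eq_iff normal_word_in_lists)
qed

section \<open>Conjugacy\<close>

lemma conj_dom_zero_elt: "conj_dom (polycyclic n) zero_elt = {zero_elt}"
  by (simp add: conj_dom_def is_zero_iff)

lemma conj_dom_subset_carrier:
  "a \<in> carrier (polycyclic n) \<Longrightarrow> conj_dom (polycyclic n) a \<subseteq> carrier (polycyclic n)"
  by (auto simp: conj_dom_def)

lemma conj_domD: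
  assumes "g \<in> conj_dom (polycyclic n) a" "m \<in> carrier (polycyclic n)" "a \<noteq> zero_elt"
    and "m \<otimes>\<^bsub>polycyclic n\<^esub> a \<otimes>\<^bsub>polycyclic n\<^esub> g = zero_elt"
  shows "m \<otimes>\<^bsub>polycyclic n\<^esub> a = zero_elt"
  using assms by (auto simp: conj_dom_def is_zero_iff)

text \<open>This is the defining condition at \<open>m = 1\<close>.\<close>

lemma conj_dom_mult_ne_zero:
  assumes "g \<in> conj_dom (polycyclic n) a" "a \<in> carrier (polycyclic n)" "a \<noteq> zero_elt"
  shows "a \<otimes>\<^bsub>polycyclic n\<^esub> g \<noteq> zero_elt"
proof -
  interpret monoid "polycyclic n"
    unfolding polycyclic_def by (rule monoid_presented_monoid)
  show ?thesis using conj_domD[OF assms(1) one_closed assms(3)] assms by auto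
qed

text \<open>If \<open>b\<close> is zero then so is \<open>a g = g b\<close>, which is impossible for
  nonzero \<open>a\<close>. The other direction uses \<open>h\<close>.\<close>

lemma conj_c_zero_iff:
  assumes "(a, b) \<in> conj_c (polycyclic n)"
  shows "a = zero_elt \<longleftrightarrow> b = zero_elt"
proof -
  obtain g h where ab: "a \<in> carrier (polycyclic n)" "b \<in> carrier (polycyclic n)"
    and g: "g \<in> conj_dom (polycyclic n) a" "a \<otimes>\<^bsub>polycyclic n\<^esub> g = g \<otimes>\<^bsub>polycyclic n\<^esub> b"
    and h: "h \<in> conj_dom (polycyclic n) b" "b \<otimes>\<^bsub>polycyclic n\<^esub> h = h \<otimes>\<^bsub>polycyclic n\<^esub> a"
    using assms by (auto simp: conj_c_def)
  have gh: "g \<in> carrier (polycyclic n)" "h \<in> carrier (polycyclic n)"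
    using ab g h conj_dom_subset_carrier by blast+
  show ?thesis
    using conj_dom_mult_ne_zero[OF g(1) ab(1)] conj_dom_mult_ne_zero[OF h(1) ab(2)]
      g(2) h(2) zero_elt_mult(2) gh by metis
qed

text \<open>Otherwise some extension \<open>x t\<close> is incomparable with \<open>v\<close>. Then
  \<open>m = (y t)^-1\<close> gives \<open>m a = (x t)^-1\<close>, which is nonzero but annihilated
  by \<open>g\<close>.\<close>

lemma conj_dom_normal_elt_prefix:
  assumes n: "n \<ge> 2" and ws: "y \<in> words" "x \<in> words" "v \<in> words" "u \<in> words"
    and g: "normal_elt v u \<in> conj_dom (polycyclic n) (normal_elt y x)"
  shows "prefix v x"
proof (rule ccontr)
  assume not: "\<not> prefix v x"
  obtain t where t: "t \<in> words" "(x @ t) \<parallel> v"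
  proof (cases "prefix x v")
    case True
    then obtain i w where v: "v = x @ i # w"
      using not by (metis append_Nil2 neq_Nil_conv prefixE prefix_order.refl)
    \<comment> \<open>A generator other than \<open>i\<close>, so that \<open>x @ [j]\<close>
      branches off from \<open>v\<close>; it exists since \<open>n \<ge> 2\<close>.\<close>
    define j where "j = (if i = 1 then 2 else 1 :: nat)"
    have "[j] \<in> words" "(x @ [j]) \<parallel> v"
      using n by (auto simp: j_def v parallel_def)
    then show ?thesis using that by blast
  next
    case False
    then show ?thesis using not that[of "[]"] by (simp add: parallel_def)
  qed
  let ?m = "normal_elt [] (y @ t)"
  have m: "?m \<otimes>\<^bsub>polycyclic n\<^esub> normal_elt y x = normal_elt [] (x @ t)"
    using ws t by (intro normal_elt_mult_right) auto
  have "?m \<otimes>\<^bsub>polycyclic n\<^esub> normal_elt y x \<otimes>\<^bsub>polycyclic n\<^esub> normal_elt v u = zero_elt"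
    unfolding m using ws t by (intro normal_elt_mult_zero) auto
  then have "normal_elt [] (x @ t) = zero_elt"
    using conj_domD[OF g, of ?m] m ws t normal_elt_carrier normal_elt_ne_zero by simp
  moreover have "normal_elt [] (x @ t) \<noteq> zero_elt"
    using ws t by (intro normal_elt_ne_zero) auto
  ultimately show False by simp
qed

section \<open>Explicit factorizations witnessing \<open>conj_p\<close>\<close>

lemma conj_pI:
  "a = c \<otimes>\<^bsub>M\<^esub> d \<Longrightarrow> b = d \<otimes>\<^bsub>M\<^esub> c \<Longrightarrow> c \<in> carrier M \<Longrightarrow> d \<in> carrier M \<Longrightarrow>
    a \<in> carrier M \<Longrightarrow> b \<in> carrier M \<Longrightarrow> (a, b) \<in> conj_p M"
  by (auto simp: conj_p_def)

text \<open>With \<open>c = s w^-1\<close> the elements are \<open>v c v^-1\<close> and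
  \<open>u c u^-1\<close>; the factors are \<open>v c u^-1\<close> and
  \<open>u v^-1\<close>.\<close>

lemma conj_p_sandwich:
  assumes "u \<in> words" "v \<in> words" "s \<in> words" "w \<in> words"
  shows "(normal_elt (v @ s) (v @ w), normal_elt (u @ s) (u @ w)) \<in> conj_p (polycyclic n)"
proof (rule conj_pI)
  show "normal_elt (v @ s) (v @ w) = normal_elt (v @ s) (u @ w) \<otimes>\<^bsub>polycyclic n\<^esub> normal_elt u v"
    using assms by (subst normal_elt_mult_right) auto
  show "normal_elt (u @ s) (u @ w) = normal_elt u v \<otimes>\<^bsub>polycyclic n\<^esub> normal_elt (v @ s) (u @ w)"
    using assms by (subst normal_elt_mult_left) auto
qed (use assms normal_elt_carrier in auto)

text \<open>The factors \<open>y p^-1 z^-1\<close> and \<open>z q^-1 y^-1\<close> multiply to the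
  two elements in the two orders.\<close>

lemma conj_p_rotate:
  assumes "y \<in> words" "z \<in> words" "p \<in> words" "q \<in> words"
  shows "(normal_elt y (y @ q @ p), normal_elt z (z @ p @ q)) \<in> conj_p (polycyclic n)"
proof (rule conj_pI)
  show "normal_elt y (y @ q @ p) = normal_elt y (z @ p) \<otimes>\<^bsub>polycyclic n\<^esub> normal_elt z (y @ q)"
    using assms by (subst normal_elt_mult_right) auto
  show "normal_elt z (z @ p @ q) = normal_elt z (y @ q) \<otimes>\<^bsub>polycyclic n\<^esub> normal_elt y (z @ p)"
    using assms by (subst normal_elt_mult_right) auto
qed (use assms normal_elt_carrier in auto)

text \<open>Compares the normal forms of \<open>a g\<close> and \<open>g b\<close>. For
  \<open>y' = u s\<close> the elements form a sandwich; for \<open>u = y' s\<close> they are related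
  by a rotation.\<close>

lemma conj_p_normal_eltI:
  assumes n: "n \<ge> 2" and ws: "y \<in> words" "x \<in> words" "y' \<in> words" "x' \<in> words"
    and g: "g \<in> conj_dom (polycyclic n) (normal_elt y x)"
    and comm: "normal_elt y x \<otimes>\<^bsub>polycyclic n\<^esub> g = g \<otimes>\<^bsub>polycyclic n\<^esub> normal_elt y' x'"
  shows "(normal_elt y x, normal_elt y' x') \<in> conj_p (polycyclic n)"
proof -
  have a: "normal_elt y x \<in> carrier (polycyclic n)" "normal_elt y x \<noteq> zero_elt"
    using ws normal_elt_carrier normal_elt_ne_zero by auto
  then have ne: "normal_elt y x \<otimes>\<^bsub>polycyclic n\<^esub> g \<noteq> zero_elt"
    using conj_dom_mult_ne_zero g by blast
  have "g \<noteq> zero_elt" using ne zero_elt_mult(2)[OF a(1)] by auto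
  moreover have "g \<in> carrier (polycyclic n)" using g a conj_dom_subset_carrier by blast
  ultimately obtain v u where vu: "v \<in> words" "u \<in> words" and g_eq: "g = normal_elt v u"
    by (elim polycyclic_cases) auto
  obtain w where x: "x = v @ w"
    using conj_dom_normal_elt_prefix[OF n ws(1,2) vu] g g_eq by (auto elim: prefixE)
  have w: "w \<in> words" using ws x by auto
  have prod: "normal_elt y (u @ w) = normal_elt v u \<otimes>\<^bsub>polycyclic n\<^esub> normal_elt y' x'"
    using comm normal_elt_mult_right[OF ws(1) vu w] by (simp add: g_eq x)
  have "\<not> u \<parallel> y'"
    \<comment> \<open>Incomparable \<open>u\<close> and \<open>y'\<close> would make
      \<open>g b\<close>, hence \<open>a g\<close>, zero.\<close>
    using normal_elt_mult_zero[OF vu ws(3,4)] ne comm g_eq by auto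
  then consider s where "y' = u @ s" | s where "u = y' @ s"
    by (auto simp: parallel_def elim: prefixE)
  then show ?thesis
  proof cases
    case 1
    then have s: "s \<in> words" using ws by auto
    have "normal_elt y (u @ w) = normal_elt (v @ s) x'"
      using prod normal_elt_mult_left[OF vu ws(4) s] by (simp add: 1)
    then have "y = v @ s \<and> u @ w = x'"
      using normal_elt_eq_iff[OF ws(1), of "u @ w"] vu w by auto
    then show ?thesis using conj_p_sandwich[OF vu(2,1) s w] by (simp add: x 1)
  next
    case 2
    then have s: "s \<in> words" using vu by auto
    have "normal_elt y (u @ w) = normal_elt v (x' @ s)"
      using prod normal_elt_mult_right[OF vu(1) ws(3,4) s] by (simp add: 2)
    then have yv: "y = v" and uw: "y' @ s @ w = x' @ s"
      using normal_elt_eq_iff[OF ws(1), of "u @ w"] vu w 2 by auto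
    \<comment> \<open>Cancelling the length of \<open>s\<close> shows that \<open>y'\<close> is
      short enough to be a prefix of \<open>x'\<close>.\<close>
    have "length (y' @ s @ w) = length (x' @ s)" using uw by simp
    then have "length y' \<le> length x'" by simp
    then obtain w' where x': "x' = y' @ w'" and "s @ w = w' @ s"
      using uw by (metis append_assoc append_eq_append_conv_if append_take_drop_id same_append_eq)
    then obtain p q where "w = q @ p" "w' = p @ q"
      using conjugate_words by blast
    then show ?thesis using conj_p_rotate[of y y' p q] ws w yv x x' by simp
  qed
qed

lemma conj_c_subset_conj_p:
  assumes "n \<ge> 2"
  shows "conj_c (polycyclic n) \<subseteq> conj_p (polycyclic n)"
proof (rule subrelI)
  fix a b assume ab: "(a, b) \<in> conj_c (polycyclic n)"
  then obtain g where carr: "a \<in> carrier (polycyclic n)" "b \<in> carrier (polycyclic n)"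
    and g: "g \<in> conj_dom (polycyclic n) a" "a \<otimes>\<^bsub>polycyclic n\<^esub> g = g \<otimes>\<^bsub>polycyclic n\<^esub> b"
    by (auto simp: conj_c_def)
  show "(a, b) \<in> conj_p (polycyclic n)"
  proof (cases "a = zero_elt")
    case True
    then show ?thesis
      using conj_c_zero_iff[OF ab] zero_elt_carrier zero_elt_mult
      by (intro conj_pI[where c = zero_elt and d = zero_elt]) auto
  next
    case False
    then show ?thesis
      using conj_c_zero_iff[OF ab] carr g conj_p_normal_eltI[OF assms]
      by (elim polycyclic_cases) auto
  qed
qed

lemma conj_c_ne_conj_p:
  assumes "n \<ge> 2"
  shows "conj_c (polycyclic n) \<noteq> conj_p (polycyclic n)"
proof -
  have ws: "[] \<in> words" "[1] \<in> words" "[2] \<in> words" using assms by auto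
  have "(zero_elt, normal_elt [2] [1]) \<in> conj_p (polycyclic n)"
  proof (rule conj_pI)
    \<comment> \<open>The one-letter words \<open>[1]\<close> and \<open>[2]\<close> are
      incomparable, so this product vanishes; the reversed product does not.\<close>
    show "zero_elt = normal_elt [] [1] \<otimes>\<^bsub>polycyclic n\<^esub> normal_elt [2] []"
      using ws by (subst normal_elt_mult_zero) (auto simp: parallel_def)
    show "normal_elt [2] [1] = normal_elt [2] [] \<otimes>\<^bsub>polycyclic n\<^esub> normal_elt [] [1]"
      using normal_elt_mult_left[OF ws(3,1,2,1)] by simp
  qed (use ws normal_elt_carrier zero_elt_carrier in auto)
  moreover have "(zero_elt, normal_elt [2] [1]) \<notin> conj_c (polycyclic n)"
    using conj_c_zero_iff normal_elt_ne_zero[OF ws(3,2)] by blast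
  ultimately show ?thesis by blast
qed

end

theorem corollary3p10:
  fixes n :: nat
  assumes "n \<ge> 2"
  shows "conj_c (polycyclic n) \<subseteq> conj_p (polycyclic n)
    \<and> conj_c (polycyclic n) \<noteq> conj_p (polycyclic n)"
  using conj_c_subset_conj_p[OF assms] conj_c_ne_conj_p[OF assms] ..

end
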